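(* Let $\Gamma$ be a simplicial complex on vertex set $V$ with $|V|=n$, and let $s$ be a positive integer. Then $$\chi_s(\Gamma;-1)=\sum_{\substack{F\in\mathcal{F}(\Gamma^{(1)})\\ \dim\Gamma_{V,F}<s}}(-1)^{c(F)}\,a(\Gamma^{(1)}/F).$$
   Context: A finite simplicial complex is a collection of subsets (faces) of a finite set closed under subsets; $\dim X=|X|-1$, and $\dim$ of a complex is its maximal face dimension. An $s$-simplicial coloring of $\Gamma$ is a map $f:V\to\{1,2,\dots\}$ such that every face contains at most $s$ vertices of any given color. $\chi_s(\Gamma;t)$ is the number of $s$-simplicial colorings of $\Gamma$ using colors $\{1,\dots,t\}$; it is a polynomial in $t$, and $\chi_s(\Gamma;-1)$ denotes its value at $t=-1$. $\Gamma^{(1)}$ is the 1-skeleton (faces of dimension $\le1$), viewed as a simple graph on $V$. For a graph $G=(V,E)$, a flat is a set $F\subseteq E$ such that every connected component of $(V,F)$ is an induced subgraph of $G$; $\mathcal{F}(G)$ is the set of flats, $c(F)$ the number of connected components of $(V,F)$, $G/F$ the graph obtained by contracting the edges of $F$, and $a(G)$ the number of acyclic orientations of $G$. For a flat $F$ of $\Gamma^{(1)}$, $\Gamma_{V,F}$ is the subcomplex of $\Gamma$ with vertex set $V$ whose faces are the faces $X\in\Gamma$ all of whose 2-element subsets lie in $F$. *)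

theory Defs
  imports Complex_Main "HOL-Library.FuncSet" "HOL-Computational_Algebra.Polynomial"
begin

(* Faces may be any down-closed family of subsets of V: neither {v} \<in> \<Gamma> for v \<in> V
   nor \<Gamma> \<noteq> {} is required. *)
definition abstract_simplicial_complex :: "'a set \<Rightarrow> 'a set set \<Rightarrow> bool" where
  "abstract_simplicial_complex V \<Gamma> \<longleftrightarrow>
     finite V \<and> \<Gamma> \<subseteq> Pow V \<and> (\<forall>X\<in>\<Gamma>. \<forall>Y. Y \<subseteq> X \<longrightarrow> Y \<in> \<Gamma>)"

definition face_dim :: "'a set \<Rightarrow> int" where
  "face_dim X = int (card X) - 1"

(* The complex without faces gets dimension -1, like {{}}. *)
definition complex_dim :: "'a set set \<Rightarrow> int" where
  "complex_dim \<Gamma> = (if \<Gamma> = {} then -1 else Max (face_dim ` \<Gamma>))"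

definition skeleton :: "int \<Rightarrow> 'a set set \<Rightarrow> 'a set set" where
  "skeleton k \<Gamma> = {X \<in> \<Gamma>. face_dim X \<le> k}"

definition simplicial_colorings ::
    "'a set \<Rightarrow> 'a set set \<Rightarrow> nat \<Rightarrow> nat \<Rightarrow> ('a \<Rightarrow> nat) set" where
  "simplicial_colorings V \<Gamma> s t =
     {f \<in> V \<rightarrow>\<^sub>E {1..t}. \<forall>X\<in>\<Gamma>. \<forall>c. card {v \<in> X. f v = c} \<le> s}"

definition simplicial_chromatic_poly :: "'a set \<Rightarrow> 'a set set \<Rightarrow> nat \<Rightarrow> real poly" where
  "simplicial_chromatic_poly V \<Gamma> s =
     (THE p. \<forall>t::nat. poly p (real t) = real (card (simplicial_colorings V \<Gamma> s t)))"

(* A graph is a vertex set with a set of edges; an edge is the set of its endpoints,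
   so a one-element edge is a loop. *)
type_synonym 'a graph = "'a set \<times> 'a set set"

(* The graph of the 1-skeleton has all of V as vertices, also those v with {v} not a face. *)
definition skeleton_graph :: "'a set \<Rightarrow> 'a set set \<Rightarrow> 'a graph" where
  "skeleton_graph V \<Gamma> = (V, {X \<in> skeleton 1 \<Gamma>. face_dim X = 1})"

definition connected_in :: "'a graph \<Rightarrow> ('a \<times> 'a) set" where
  "connected_in G = {(u, v). u \<in> fst G \<and> v \<in> fst G \<and> (u, v) \<in> {(x, y). {x, y} \<in> snd G}\<^sup>*}"

(* Components are represented by their vertex sets. *)
definition graph_components :: "'a graph \<Rightarrow> 'a set set" where
  "graph_components G = fst G // connected_in G"

definition edges_within :: "'a graph \<Rightarrow> 'a set \<Rightarrow> 'a set set" where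
  "edges_within G C = {e \<in> snd G. e \<subseteq> C}"

definition flats :: "'a graph \<Rightarrow> 'a set set set" where
  "flats G = {F. F \<subseteq> snd G \<and>
     (\<forall>C \<in> graph_components (fst G, F). edges_within (fst G, F) C = edges_within G C)}"

(* G/F: vertices are the components of (V,F), and each edge of G outside F joins the
   components of its endpoints. An edge outside F with both endpoints in one component would
   become a loop; this does not occur for flats. Parallel edges are identified, which does not
   change the number of acyclic orientations. *)
definition graph_contraction :: "'a graph \<Rightarrow> 'a set set \<Rightarrow> 'a set graph" where
  "graph_contraction G F =
     (graph_components (fst G, F),
      (\<lambda>e. (\<lambda>v. connected_in (fst G, F) `` {v}) ` e) ` (snd G - F))"

(* An orientation is a set of arcs containing exactly one arc for each edge. *)
definition acyclic_orientations :: "'a graph \<Rightarrow> ('a \<times> 'a) set set" where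
  "acyclic_orientations G = {D. bij_betw (\<lambda>(u, v). {u, v}) D (snd G) \<and> acyclic D}"

(* The subcomplex written \<Gamma> with subscript V,F. *)
definition flat_subcomplex :: "'a set set \<Rightarrow> 'a set set \<Rightarrow> 'a set set" where
  "flat_subcomplex \<Gamma> F = {X \<in> \<Gamma>. \<forall>Y. Y \<subseteq> X \<and> card Y = 2 \<longrightarrow> Y \<in> F}"

end

theory Submission imports Defs begin

text \<open>
  The edges that are monochromatic under a coloring \<open>f\<close> form a flat, and \<open>f\<close> is an \<open>s\<close>-simplicial
  coloring iff this flat \<open>F\<close> satisfies \<open>dim \<Gamma>\<^sub>V\<^sub>,\<^sub>F < s\<close>. The colorings with a given flat
  correspond to the proper colorings of the contraction \<open>G/F\<close>, so the chromatic polynomial of \<open>\<Gamma>\<close>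
  is a sum of chromatic polynomials of graphs, and Stanley's theorem
  \<open>\<chi>\<^sub>G(-1) = (-1)\<^sup>|\<^sup>V\<^sup>| a(G)\<close> gives the claim.

  Stanley's theorem is proved by induction on the vertices, without deletion and contraction.
  Splitting off the last color class gives \<open>\<chi>\<^sub>G(t + 1) = \<Sum>\<^sub>S \<chi>\<^sub>G\<^sub>-\<^sub>S(t)\<close>, summed over the independent
  sets \<open>S\<close>; at \<open>t = -1\<close> the left side is \<open>\<chi>\<^sub>G(0)\<close>,
  which vanishes for nonempty \<open>V\<close>. The numbers
  \<open>(-1)\<^sup>|\<^sup>V\<^sup>| a(G)\<close> satisfy the same recursion, because acyclic orientations of \<open>G - S\<close> are those
  acyclic orientations of \<open>G\<close> in which all vertices of \<open>S\<close> are sinks.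
\<close>

section \<open>Simple graphs, vertex deletion and independent sets\<close>

definition simple_graph :: "'a graph \<Rightarrow> bool" where
  "simple_graph G \<longleftrightarrow> finite (fst G) \<and> (\<forall>e\<in>snd G. e \<subseteq> fst G \<and> card e = 2)"

definition proper_colorings :: "'a graph \<Rightarrow> nat \<Rightarrow> ('a \<Rightarrow> nat) set" where
  "proper_colorings G t =
     {f \<in> fst G \<rightarrow>\<^sub>E {1..t}. \<forall>u v. {u, v} \<in> snd G \<longrightarrow> f u \<noteq> f v}"

definition delete_vertices :: "'a graph \<Rightarrow> 'a set \<Rightarrow> 'a graph" where
  "delete_vertices G S = (fst G - S, {e \<in> snd G. e \<inter> S = {}})"

definition independent_sets :: "'a graph \<Rightarrow> 'a set set" where
  "independent_sets G = {S. S \<subseteq> fst G \<and> (\<forall>e\<in>snd G. \<not> e \<subseteq> S)}"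

lemma simple_graphD:
  assumes "simple_graph G"
  shows "finite (fst G)" "finite (snd G)"
    and "{u, v} \<in> snd G \<Longrightarrow> u \<in> fst G \<and> v \<in> fst G \<and> u \<noteq> v"
proof -
  show fin: "finite (fst G)" using assms by (simp add: simple_graph_def)
  have "snd G \<subseteq> Pow (fst G)" using assms by (auto simp: simple_graph_def)
  then show "finite (snd G)" using fin by (metis finite_Pow_iff finite_subset)
  show "{u, v} \<in> snd G \<Longrightarrow> u \<in> fst G \<and> v \<in> fst G \<and> u \<noteq> v"
    using assms unfolding simple_graph_def by (fastforce simp: card_insert_if)
qed

lemma simple_graph_edgeE:
  assumes "simple_graph G" "e \<in> snd G"
  obtains u v where "e = {u, v}" "u \<noteq> v" "u \<in> fst G" "v \<in> fst G"
proof -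
  have "card e = 2" using assms by (auto simp: simple_graph_def)
  then obtain u v where "e = {u, v}" "u \<noteq> v" by (auto simp: card_2_iff)
  then show thesis using that assms by (auto simp: simple_graph_def)
qed

lemma simple_graph_delete_vertices: "simple_graph G \<Longrightarrow> simple_graph (delete_vertices G S)"
  by (auto simp: simple_graph_def delete_vertices_def)

lemma finite_proper_colorings: "finite (fst G) \<Longrightarrow> finite (proper_colorings G t)"
  unfolding proper_colorings_def
  by (rule finite_subset[OF _ finite_PiE[of "fst G" "\<lambda>_. {1..t}"]]) auto

lemma finite_independent_sets: "finite (fst G) \<Longrightarrow> finite (independent_sets G)"
  unfolding independent_sets_def by (rule finite_subset[of _ "Pow (fst G)"]) auto

subsection \<open>Proper colorings\<close>

text \<open>Forgetting the colors on \<open>S\<close> is inverted by giving color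
  \<open>Suc t\<close> to all of \<open>S\<close>. The extension is proper because \<open>S\<close>
  is independent and the colors off \<open>S\<close> are at most \<open>t\<close>; for the same
  reason its last color class is exactly \<open>S\<close>.\<close>

lemma card_proper_colorings_last_color_class:
  assumes G: "simple_graph G" and S: "S \<in> independent_sets G"
  shows "card {f \<in> proper_colorings G (Suc t). {v \<in> fst G. f v = Suc t} = S}
    = card (proper_colorings (delete_vertices G S) t)"
proof (rule bij_betw_same_card)
  \<comment> \<open>The outer restriction to \<open>fst G\<close> makes the extended coloring
    undefined outside the vertex set, as the extensional function space demands.\<close>
  let ?ext = "\<lambda>h. \<lambda>v\<in>fst G. if v \<in> S then Suc t else h v"
  have SV: "S \<subseteq> fst G" and ind: "\<And>u v. {u, v} \<in> snd G \<Longrightarrow> u \<notin> S \<or> v \<notin> S"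
    using S by (auto simp: independent_sets_def)
  show "bij_betw (\<lambda>f. restrict f (fst G - S))
      {f \<in> proper_colorings G (Suc t). {v \<in> fst G. f v = Suc t} = S}
      (proper_colorings (delete_vertices G S) t)"
  proof (rule bij_betw_byWitness[where f' = ?ext])
    show "\<forall>f\<in>{f \<in> proper_colorings G (Suc t). {v \<in> fst G. f v = Suc t} = S}.
        ?ext (restrict f (fst G - S)) = f"
      by (auto simp: proper_colorings_def fun_eq_iff PiE_def extensional_def)
    show "\<forall>h\<in>proper_colorings (delete_vertices G S) t. restrict (?ext h) (fst G - S) = h"
      by (auto simp: proper_colorings_def delete_vertices_def fun_eq_iff PiE_def extensional_def)
    show "(\<lambda>f. restrict f (fst G - S)) `
        {f \<in> proper_colorings G (Suc t). {v \<in> fst G. f v = Suc t} = S}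
        \<subseteq> proper_colorings (delete_vertices G S) t"
    proof (rule image_subsetI)
      fix f assume "f \<in> {f \<in> proper_colorings G (Suc t). {v \<in> fst G. f v = Suc t} = S}"
      then have f: "f \<in> proper_colorings G (Suc t)" and S: "S = {v \<in> fst G. f v = Suc t}" by auto
      have "f v \<in> {1..t}" if "v \<in> fst G - S" for v
      proof -
        have "f v \<in> {1..Suc t}" using f that by (auto simp: proper_colorings_def)
        then show ?thesis using that S by auto
      qed
      then have "restrict f (fst G - S) \<in> fst G - S \<rightarrow>\<^sub>E {1..t}" by auto
      moreover have "restrict f (fst G - S) u \<noteq> restrict f (fst G - S) v"
        if e: "{u, v} \<in> snd G" "{u, v} \<inter> S = {}" for u v
        using simple_graphD(3)[OF G e(1)] e f by (auto simp: proper_colorings_def)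
      ultimately show "restrict f (fst G - S) \<in> proper_colorings (delete_vertices G S) t"
        by (auto simp: proper_colorings_def delete_vertices_def)
    qed
    show "?ext ` proper_colorings (delete_vertices G S) t
        \<subseteq> {f \<in> proper_colorings G (Suc t). {v \<in> fst G. f v = Suc t} = S}"
    proof (rule image_subsetI)
      fix h assume h: "h \<in> proper_colorings (delete_vertices G S) t"
      then have range: "h v \<in> {1..t}" if "v \<in> fst G" "v \<notin> S" for v
        using that by (auto simp: proper_colorings_def delete_vertices_def)
      have "?ext h \<in> fst G \<rightarrow>\<^sub>E {1..Suc t}" using range by fastforce
      moreover have "?ext h u \<noteq> ?ext h v" if e: "{u, v} \<in> snd G" for u v
      proof -
        have "u \<in> fst G" "v \<in> fst G" using simple_graphD(3)[OF G e] by auto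
        moreover have "h u \<noteq> h v" if "u \<notin> S" "v \<notin> S"
          using h e that by (auto simp: proper_colorings_def delete_vertices_def)
        ultimately show ?thesis using range[of u] range[of v] ind[OF e] by auto
      qed
      moreover have "{v \<in> fst G. ?ext h v = Suc t} = S"
      proof -
        have "?ext h v = Suc t \<longleftrightarrow> v \<in> S" if "v \<in> fst G" for v
          using range[OF that] that by auto
        then show ?thesis using SV by blast
      qed
      ultimately show "?ext h \<in> {f \<in> proper_colorings G (Suc t). {v \<in> fst G. f v = Suc t} = S}"
        unfolding proper_colorings_def by blast
    qed
  qed
qed

text \<open>Each color class of a proper coloring is independent, so the colorings can be sorted by
  the class of the last color, which may be empty.\<close>

lemma card_proper_colorings_Suc:
  assumes G: "simple_graph G"
  shows "card (proper_colorings G (Suc t))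
    = (\<Sum>S\<in>independent_sets G. card (proper_colorings (delete_vertices G S) t))"
proof -
  have "{v \<in> fst G. f v = Suc t} \<in> independent_sets G" if f: "f \<in> proper_colorings G (Suc t)" for f
  proof -
    have "\<not> e \<subseteq> {v \<in> fst G. f v = Suc t}" if e: "e \<in> snd G" for e
    proof -
      obtain u v where "e = {u, v}" using simple_graph_edgeE[OF G e] .
      then have "f u \<noteq> f v" using f e by (simp add: proper_colorings_def)
      then show ?thesis using \<open>e = {u, v}\<close> by auto
    qed
    then show ?thesis by (auto simp: independent_sets_def)
  qed
  then have "(\<lambda>f. {v \<in> fst G. f v = Suc t}) ` proper_colorings G (Suc t) \<subseteq> independent_sets G"
    by (rule image_subsetI)
  from sum.group[OF _ _ this, of "\<lambda>_. 1::nat"] have "card (proper_colorings G (Suc t)) =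
      (\<Sum>S\<in>independent_sets G. card {f \<in> proper_colorings G (Suc t). {v \<in> fst G. f v = Suc t} = S})"
    using simple_graphD(1)[OF G] by (simp add: finite_proper_colorings finite_independent_sets)
  then show ?thesis using card_proper_colorings_last_color_class[OF G] by simp
qed

subsection \<open>Acyclic orientations and sinks\<close>

text \<open>Two opposite arcs would form a cycle of length two, so for acyclic \<open>D\<close> the
  map from arcs to edges is automatically injective. Of the bijection only the condition on its
  image remains.\<close>

lemma acyclic_orientations_iff:
  assumes G: "simple_graph G"
  shows "D \<in> acyclic_orientations G \<longleftrightarrow>
    (\<forall>u v. (u, v) \<in> D \<longrightarrow> {u, v} \<in> snd G) \<and>
    (\<forall>u v. {u, v} \<in> snd G \<longrightarrow> (u, v) \<in> D \<or> (v, u) \<in> D) \<and> acyclic D"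
proof -
  have inj: "inj_on (\<lambda>(u, v). {u, v}) D" if D: "acyclic D"
  proof (rule inj_onI, clarify)
    fix u v x y assume "(u, v) \<in> D" "(x, y) \<in> D" "{u, v} = {x, y}"
    moreover have "\<not> ((u, v) \<in> D \<and> (v, u) \<in> D)"
      using D by (meson acyclic_def r_into_trancl trancl_trans)
    ultimately show "u = x \<and> v = y" by (auto simp: doubleton_eq_iff)
  qed
  have "(\<lambda>(u, v). {u, v}) ` D = snd G \<longleftrightarrow> (\<forall>u v. (u, v) \<in> D \<longrightarrow> {u, v} \<in> snd G) \<and>
    (\<forall>u v. {u, v} \<in> snd G \<longrightarrow> (u, v) \<in> D \<or> (v, u) \<in> D)" (is "?im = _ \<longleftrightarrow> ?sub \<and> ?sup")
  proof
    assume im: "?im = snd G"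
    have ?sub using im by blast
    moreover have ?sup
    proof (intro allI impI)
      fix u v assume "{u, v} \<in> snd G"
      then have "{u, v} \<in> ?im" using im by simp
      then obtain x y where "(x, y) \<in> D" "{u, v} = {x, y}" by (auto simp del: insert_iff)
      then show "(u, v) \<in> D \<or> (v, u) \<in> D" unfolding doubleton_eq_iff by blast
    qed
    ultimately show "?sub \<and> ?sup" ..
  next
    assume *: "?sub \<and> ?sup"
    have "e \<in> ?im" if e: "e \<in> snd G" for e
    proof -
      obtain u v where uv: "e = {u, v}" using simple_graph_edgeE[OF G e] .
      have im: "{x, y} \<in> ?im" if "(x, y) \<in> D" for x y
        using imageI[OF that, of "\<lambda>(u, v). {u, v}"] by simp
      have "(u, v) \<in> D \<or> (v, u) \<in> D"
        using conjunct2[OF *, rule_format, of u v] e uv by simp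
      then show ?thesis unfolding uv using im[of u v] im[of v u] insert_commute[of u v "{}"] by argo
    qed
    then show "?im = snd G" using * by auto
  qed
  then show ?thesis unfolding acyclic_orientations_def bij_betw_def using inj by blast
qed

definition sinks :: "'a graph \<Rightarrow> ('a \<times> 'a) set \<Rightarrow> 'a set" where
  "sinks G D = {v \<in> fst G. \<forall>u. (v, u) \<notin> D}"

lemma finite_acyclic_orientations:
  assumes G: "simple_graph G"
  shows "finite (acyclic_orientations G)" "D \<in> acyclic_orientations G \<Longrightarrow> finite D"
proof -
  have sub: "D \<subseteq> fst G \<times> fst G" if "D \<in> acyclic_orientations G" for D
    using that simple_graphD(3)[OF G] by (auto simp: acyclic_orientations_iff[OF G])
  have fin: "finite (fst G \<times> fst G)" using simple_graphD(1)[OF G] by simp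
  have "acyclic_orientations G \<subseteq> Pow (fst G \<times> fst G)" using sub by blast
  then show "finite (acyclic_orientations G)" using fin by (metis finite_Pow_iff finite_subset)
  show "finite D" if "D \<in> acyclic_orientations G"
    using sub[OF that] fin by (rule finite_subset)
qed

text \<open>A finite acyclic relation has a well-founded converse, and a minimal vertex for the
  converse has no outgoing arc.\<close>

lemma sinks_nonempty:
  assumes G: "simple_graph G" and D: "D \<in> acyclic_orientations G" and "fst G \<noteq> {}"
  shows "sinks G D \<noteq> {}"
proof -
  have "wf (D\<inverse>)"
    using finite_acyclic_wf_converse finite_acyclic_orientations(2)[OF G D] D
    by (auto simp: acyclic_orientations_iff[OF G])
  moreover obtain x where "x \<in> fst G" using assms by auto
  ultimately obtain v where "v \<in> fst G" "\<And>u. (u, v) \<in> D\<inverse> \<Longrightarrow> u \<notin> fst G"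
    by (metis wfE_min)
  moreover have "u \<in> fst G" if "(v, u) \<in> D" for u
    using that D simple_graphD(3)[OF G] by (auto simp: acyclic_orientations_iff[OF G])
  ultimately show ?thesis by (auto simp: sinks_def)
qed

text \<open>No arc leaves \<open>S\<close>, so a path that uses an arc of \<open>A\<close> ends
  right there, in \<open>S\<close>. A cycle cannot start in \<open>S\<close>, hence it would run
  entirely inside \<open>D\<close>.\<close>

lemma acyclic_Un_arcs_into_sinks:
  assumes D: "acyclic D" and A: "\<And>u v. (u, v) \<in> A \<Longrightarrow> v \<in> S"
    and S: "\<And>u v. (u, v) \<in> D \<union> A \<Longrightarrow> u \<notin> S"
  shows "acyclic (D \<union> A)"
proof -
  have "(x, y) \<in> D\<^sup>+ \<or> y \<in> S" if "(x, y) \<in> (D \<union> A)\<^sup>+" for x y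
    using that by induction (use A S in \<open>auto intro: trancl_into_trancl\<close>)
  moreover have "x \<notin> S" if "(x, y) \<in> (D \<union> A)\<^sup>+" for x y
    using tranclD[OF that] S by auto
  ultimately show ?thesis using D unfolding acyclic_def by blast
qed

text \<open>If all of \<open>S\<close> are sinks, every edge meeting \<open>S\<close> must point
  into \<open>S\<close>, and independence leaves it exactly one end there. Hence \<open>D\<close> is
  determined by its arcs outside \<open>S\<close>; conversely, adding the forced arcs
  \<open>?A\<close> creates no cycle.\<close>

lemma card_acyclic_orientations_sinks:
  assumes G: "simple_graph G" and S: "S \<in> independent_sets G"
  shows "card {D \<in> acyclic_orientations G. S \<subseteq> sinks G D}
    = card (acyclic_orientations (delete_vertices G S))"
proof (rule bij_betw_same_card)
  let ?A = "{(u, v). {u, v} \<in> snd G \<and> v \<in> S}" and ?AOS = "{D \<in> acyclic_orientations G. S \<subseteq> sinks G D}"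
  have SV: "S \<subseteq> fst G" and ind: "\<And>u v. {u, v} \<in> snd G \<Longrightarrow> v \<in> S \<Longrightarrow> u \<notin> S"
    using S by (auto simp: independent_sets_def)
  note AO = acyclic_orientations_iff[OF G]
  have AOd: "D \<in> acyclic_orientations (delete_vertices G S) \<longleftrightarrow>
      (\<forall>u v. (u, v) \<in> D \<longrightarrow> {u, v} \<in> snd G \<and> u \<notin> S \<and> v \<notin> S) \<and>
      (\<forall>u v. {u, v} \<in> snd G \<longrightarrow> u \<notin> S \<longrightarrow> v \<notin> S \<longrightarrow> (u, v) \<in> D \<or> (v, u) \<in> D) \<and> acyclic D" for D
    unfolding acyclic_orientations_iff[OF simple_graph_delete_vertices[OF G]]
    by (simp add: delete_vertices_def) blast
  show "bij_betw (\<lambda>D. D \<inter> (- S) \<times> (- S)) ?AOS (acyclic_orientations (delete_vertices G S))"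
  proof (rule bij_betw_byWitness[where f' = "\<lambda>D. D \<union> ?A"]; (intro ballI image_subsetI)?)
    fix D assume "D \<in> ?AOS"
    then have D: "D \<in> acyclic_orientations G" and sink: "\<And>u v. u \<in> S \<Longrightarrow> (u, v) \<notin> D"
      by (auto simp: sinks_def)
    \<comment> \<open>On pairs that meet \<open>S\<close>, the orientation \<open>D\<close> agrees
      with \<open>?A\<close>.\<close>
    have "(u, v) \<in> D \<longleftrightarrow> {u, v} \<in> snd G \<and> v \<in> S" if "u \<in> S \<or> v \<in> S" for u v
      using D sink that unfolding AO by (metis ind)
    then show "D \<inter> (- S) \<times> (- S) \<union> ?A = D" by (auto simp del: insert_iff dest: ind)
    have "acyclic (D \<inter> (- S) \<times> (- S))"
      using D unfolding AO by (meson Int_lower1 acyclic_subset)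
    then show "D \<inter> (- S) \<times> (- S) \<in> acyclic_orientations (delete_vertices G S)"
      using D unfolding AO AOd by blast
  next
    fix D assume D: "D \<in> acyclic_orientations (delete_vertices G S)"
    then have arc: "{u, v} \<in> snd G \<and> u \<notin> S \<and> v \<notin> S" if "(u, v) \<in> D" for u v
      using that unfolding AOd by blast
    then show "(D \<union> ?A) \<inter> (- S) \<times> (- S) = D" by auto
    have out: "u \<notin> S" if "(u, v) \<in> D \<union> ?A" for u v
      using that arc ind by blast
    have "acyclic (D \<union> ?A)"
    proof (rule acyclic_Un_arcs_into_sinks[where S = S])
      show "acyclic D" using D unfolding AOd by blast
      show "v \<in> S" if "(u, v) \<in> ?A" for u v using that by simp
    qed (rule out)
    moreover have "(u, v) \<in> D \<union> ?A \<or> (v, u) \<in> D \<union> ?A" if e: "{u, v} \<in> snd G" for u v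
    proof -
      have "{v, u} \<in> snd G" using e by (simp add: insert_commute)
      then show ?thesis using e D unfolding AOd by blast
    qed
    moreover have "{u, v} \<in> snd G" if "(u, v) \<in> D \<union> ?A" for u v
      using arc that by blast
    moreover have "S \<subseteq> sinks G (D \<union> ?A)" using out SV unfolding sinks_def by blast
    ultimately show "D \<union> ?A \<in> ?AOS" unfolding AO mem_Collect_eq by blast
  qed
qed

text \<open>The arc of an edge leaves one of its two ends, which is then not a sink.\<close>

lemma sinks_independent:
  assumes G: "simple_graph G" and D: "D \<in> acyclic_orientations G" and S: "S \<subseteq> sinks G D"
  shows "S \<in> independent_sets G"
proof -
  have "\<not> e \<subseteq> S" if e: "e \<in> snd G" for e
  proof -
    obtain u v where "e = {u, v}" using simple_graph_edgeE[OF G e] .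
    then have "(u, v) \<in> D \<or> (v, u) \<in> D" using D e unfolding acyclic_orientations_iff[OF G] by blast
    then show ?thesis using S \<open>e = {u, v}\<close> by (auto simp: sinks_def)
  qed
  then show ?thesis using S by (auto simp: independent_sets_def sinks_def)
qed

text \<open>This is the recursion for the numbers of acyclic orientations. Exchanging the summations
  leaves, for each orientation of \<open>G\<close>, the alternating sum over all subsets of its set
  of sinks, which vanishes because that set is nonempty.\<close>

lemma alternating_sum_acyclic_orientations:
  assumes G: "simple_graph G" and ne: "fst G \<noteq> {}"
  shows "(\<Sum>S\<in>independent_sets G.
    (-1) ^ card S * real (card (acyclic_orientations (delete_vertices G S)))) = 0"
proof -
  let ?AO = "acyclic_orientations G"
  note fin = finite_independent_sets[OF simple_graphD(1)[OF G]] finite_acyclic_orientations(1)[OF G]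
  have "(\<Sum>S\<in>independent_sets G.
      (-1) ^ card S * real (card (acyclic_orientations (delete_vertices G S))))
    = (\<Sum>S\<in>independent_sets G. \<Sum>D\<in>{D \<in> ?AO. S \<subseteq> sinks G D}. (-1) ^ card S)"
    using card_acyclic_orientations_sinks[OF G] by (auto intro!: sum.cong simp: mult.commute)
  also have "\<dots> = (\<Sum>D\<in>?AO. \<Sum>S\<in>{S \<in> independent_sets G. S \<subseteq> sinks G D}. (-1) ^ card S)"
    using fin by (rule sum.swap_restrict)
  also have "\<dots> = (\<Sum>D\<in>?AO. 0)"
  proof (rule sum.cong[OF refl])
    fix D assume D: "D \<in> ?AO"
    have "finite (sinks G D)" using simple_graphD(1)[OF G] by (simp add: sinks_def)
    moreover have "{S \<in> independent_sets G. S \<subseteq> sinks G D} = Pow (sinks G D)"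
      using sinks_independent[OF G D] by auto
    moreover have "card (sinks G D) \<noteq> 0"
      using sinks_nonempty[OF G D ne] \<open>finite (sinks G D)\<close> by simp
    \<comment> \<open>The alternating sum is the expansion of the product of the factors 1 - 1, one
      for each sink.\<close>
    ultimately show "(\<Sum>S\<in>{S \<in> independent_sets G. S \<subseteq> sinks G D}. (-1) ^ card S) = (0::real)"
      using prod_diff_conv_sum[of "sinks G D" "\<lambda>_. 1::real" "\<lambda>_. 1"]
      by (simp add: power_0_left)
  qed
  finally show ?thesis by simp
qed

subsection \<open>Stanley's theorem\<close>

text \<open>By the binomial theorem, the difference of \<open>x ^ Suc m\<close> is
  \<open>Suc m * x ^ m\<close> plus lower powers. Antidifferences of the lower powers come from the
  induction and are subtracted before dividing by \<open>Suc m\<close>.\<close>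

lemma antidifference_monom: "\<exists>p::real poly. \<forall>x. poly p (x + 1) - poly p x = x ^ m"
proof (induction m rule: less_induct)
  case (less m)
  \<comment> \<open>The bound \<open>k < m\<close> stands inside the existential so that choice
    yields a total function \<open>P\<close>.\<close>
  then have "\<forall>k. \<exists>p::real poly. k < m \<longrightarrow> (\<forall>x. poly p (x + 1) - poly p x = x ^ k)" by blast
  from choice[OF this] obtain P :: "nat \<Rightarrow> real poly"
    where P: "\<And>k x. k < m \<Longrightarrow> poly (P k) (x + 1) - poly (P k) x = x ^ k" by blast
  define p where "p = smult (1 / real (Suc m))
    (monom 1 (Suc m) - (\<Sum>k<m. smult (real (Suc m choose k)) (P k)))"
  have "poly p (x + 1) - poly p x = x ^ m" for x
  proof -
    have "(x + 1) ^ Suc m = (\<Sum>k\<le>Suc m. real (Suc m choose k) * x ^ k)"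
      by (subst binomial_ring) simp
    also have "\<dots> = (\<Sum>k<m. real (Suc m choose k) * x ^ k) + real (Suc m) * x ^ m + x ^ Suc m"
      by (simp flip: lessThan_Suc_atMost)
    finally have *: "(x + 1) ^ Suc m - x ^ Suc m =
        (\<Sum>k<m. real (Suc m choose k) * x ^ k) + real (Suc m) * x ^ m" by simp
    have "poly p (x + 1) - poly p x = ((x + 1) ^ Suc m - x ^ Suc m
        - (\<Sum>k<m. real (Suc m choose k) * (poly (P k) (x + 1) - poly (P k) x))) / real (Suc m)"
      by (simp add: p_def poly_monom poly_sum diff_divide_distrib right_diff_distrib sum_subtractf
          del: power_Suc of_nat_Suc)
    also have "\<dots> = x ^ m" unfolding * using P by (simp del: of_nat_Suc)
    finally show ?thesis .
  qed
  then show ?case by blast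
qed

text \<open>Taking differences is linear, so the antidifferences of the monomials are combined with
  the coefficients of \<open>q\<close>.\<close>

lemma antidifference_poly:
  fixes q :: "real poly"
  shows "\<exists>p. \<forall>x. poly p (x + 1) - poly p x = poly q x"
proof -
  have "\<forall>m. \<exists>p::real poly. \<forall>x. poly p (x + 1) - poly p x = x ^ m"
    using antidifference_monom by blast
  from choice[OF this] obtain P :: "nat \<Rightarrow> real poly"
    where P: "\<And>m x. poly (P m) (x + 1) - poly (P m) x = x ^ m" by blast
  have "poly (\<Sum>i\<le>degree q. smult (coeff q i) (P i)) (x + 1)
      - poly (\<Sum>i\<le>degree q. smult (coeff q i) (P i)) x = poly q x" for x
    by (simp add: poly_sum poly_altdef[of q] P flip: sum_subtractf right_diff_distrib)
  then show ?thesis by blast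
qed

text \<open>The chromatic polynomial is constructed along with its value at -1: the induction
  provides polynomials for all graphs with a nonempty independent set deleted, and their sum is the
  difference p(t + 1) - p(t) of the polynomial wanted.\<close>

lemma stanley_reciprocity:
  fixes G :: "'a graph"
  assumes "simple_graph G"
  shows "\<exists>p. (\<forall>t. poly p (real t) = real (card (proper_colorings G t))) \<and>
    poly p (-1) = (-1) ^ card (fst G) * real (card (acyclic_orientations G))"
  using assms
proof (induction "card (fst G)" arbitrary: G rule: less_induct)
  case less
  note G = less.prems
  note fin = simple_graphD(1)[OF G]
  show ?case
  proof (cases "fst G = {}")
    case True
    then have "snd G = {}" using G by (auto simp: simple_graph_def)
    \<comment> \<open>Without vertices there is one coloring and one orientation, both empty, so the
      constant polynomial 1 serves.\<close>
    then have "proper_colorings G t = {\<lambda>_. undefined}" for t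
      using True by (simp add: proper_colorings_def)
    moreover have "acyclic_orientations G = {{}}"
      using \<open>snd G = {}\<close> by (auto simp: acyclic_orientations_def bij_betw_def acyclic_def)
    ultimately show ?thesis using True by (intro exI[of _ 1]) simp
  next
    case False
    \<comment> \<open>Deleting the empty set returns \<open>G\<close> itself, to which the induction
      hypothesis does not apply. Its term in the recursion is p(t).\<close>
    define I where "I = independent_sets G - {{}}"
    have finI: "finite I" using finite_independent_sets[OF fin] by (simp add: I_def)
    have empty_notin: "{} \<notin> I" by (simp add: I_def)
    have ins: "independent_sets G = insert {} I"
      using G by (auto simp: I_def independent_sets_def simple_graph_def)
    have del: "delete_vertices G {} = G" by (simp add: delete_vertices_def)
    have card_del: "card (fst (delete_vertices G S)) = card (fst G) - card S" "card S \<le> card (fst G)"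
      if "S \<in> I" for S
      using that fin by (auto simp: I_def independent_sets_def delete_vertices_def
          card_Diff_subset card_mono finite_subset)
    have "card (fst (delete_vertices G S)) < card (fst G)" if "S \<in> I" for S
      using that fin by (auto simp: I_def independent_sets_def delete_vertices_def
          intro!: psubset_card_mono)
    then have "\<forall>S\<in>I. \<exists>p. (\<forall>t. poly p (real t) = real (card (proper_colorings (delete_vertices G S) t))) \<and>
        poly p (-1) = (-1) ^ card (fst (delete_vertices G S)) *
          real (card (acyclic_orientations (delete_vertices G S)))"
      using less.hyps simple_graph_delete_vertices[OF G] by blast
    from bchoice[OF this] obtain P :: "'a set \<Rightarrow> real poly" where
      P: "\<And>S t. S \<in> I \<Longrightarrow> poly (P S) (real t) = real (card (proper_colorings (delete_vertices G S) t))"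
      and P': "\<And>S. S \<in> I \<Longrightarrow> poly (P S) (-1) = (-1) ^ card (fst (delete_vertices G S)) *
        real (card (acyclic_orientations (delete_vertices G S)))" by blast
    obtain p0 where p0: "\<And>x. poly p0 (x + 1) - poly p0 x = poly (\<Sum>S\<in>I. P S) x"
      using antidifference_poly[of "\<Sum>S\<in>I. P S"] by blast
    \<comment> \<open>The constant is chosen so that p(0) = 0: a nonempty vertex set has no coloring
      with zero colors.\<close>
    define p where "p = p0 - [:poly p0 0:]"
    have p: "poly p (x + 1) = poly p x + (\<Sum>S\<in>I. poly (P S) x)" and p_0: "poly p 0 = 0" for x
      using p0[of x] by (auto simp: p_def poly_sum)
    have "poly p (real t) = real (card (proper_colorings G t))" for t
    proof (induction t)
      case 0
      then show ?case using False p_0 by (auto simp: proper_colorings_def PiE_eq_empty_iff)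
    next
      case (Suc t)
      have "poly p (real (Suc t)) = poly p (real t) + (\<Sum>S\<in>I. poly (P S) (real t))"
        using p[of "real t"] by (simp add: add.commute)
      then show ?case
        using Suc P finI by (simp add: card_proper_colorings_Suc[OF G] ins del empty_notin)
    qed
    moreover have "poly p (-1) = (-1) ^ card (fst G) * real (card (acyclic_orientations G))"
    proof -
      \<comment> \<open>The difference and the sum of the two cardinalities have the same
        parity.\<close>
      have sgn: "(-1) ^ card (fst (delete_vertices G S)) = (-1) ^ card (fst G) * (-1 :: real) ^ card S"
        if "S \<in> I" for S
        using card_del[OF that] by (simp add: minus_one_power_iff)
      have "real (card (acyclic_orientations G)) +
          (\<Sum>S\<in>I. (-1) ^ card S * real (card (acyclic_orientations (delete_vertices G S)))) = 0"
        using alternating_sum_acyclic_orientations[OF G False] finI by (simp add: ins del empty_notin)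
      then have alt: "(\<Sum>S\<in>I. (-1) ^ card S * real (card (acyclic_orientations (delete_vertices G S))))
          = - real (card (acyclic_orientations G))" by linarith
      \<comment> \<open>The difference equation at -1 relates p(-1) to p(0) = 0.\<close>
      have "poly p (-1) = - (\<Sum>S\<in>I. poly (P S) (-1))" using p[of "-1"] p_0 by simp
      also have "\<dots> = - ((-1) ^ card (fst G) *
          (\<Sum>S\<in>I. (-1) ^ card S * real (card (acyclic_orientations (delete_vertices G S)))))"
        by (simp add: P' sgn sum_distrib_left mult.assoc)
      also have "\<dots> = (-1) ^ card (fst G) * real (card (acyclic_orientations G))" unfolding alt by simp
      finally show ?thesis .
    qed
    ultimately show ?thesis by (intro exI[of _ p] conjI allI)
  qed
qed

subsection \<open>Monochromatic edges, flats and contractions\<close>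

lemma equiv_connected_in: "equiv (fst G) (connected_in G)"
proof (rule equivI)
  have "sym {(x, y). {x, y} \<in> snd G}" by (auto simp: sym_def insert_commute)
  then have "sym ({(x, y). {x, y} \<in> snd G}\<^sup>*)" by (rule sym_rtrancl)
  then show "sym (connected_in G)" by (auto simp: connected_in_def sym_def)
  show "refl_on (fst G) (connected_in G)" by (auto simp: connected_in_def refl_on_def)
  show "trans (connected_in G)" by (auto simp: connected_in_def trans_def intro: rtrancl_trans)
  show "connected_in G \<subseteq> fst G \<times> fst G" by (auto simp: connected_in_def)
qed

lemma connected_in_edge: "u \<in> V \<Longrightarrow> v \<in> V \<Longrightarrow> {u, v} \<in> F \<Longrightarrow> (u, v) \<in> connected_in (V, F)"
  by (auto simp: connected_in_def)

lemma constant_on_connected_in: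
  assumes const: "\<And>u v. {u, v} \<in> snd G \<Longrightarrow> f u = f v" and uv: "(u, v) \<in> connected_in G"
  shows "f u = f v"
proof -
  have "(u, v) \<in> {(x, y). {x, y} \<in> snd G}\<^sup>*" using uv by (simp add: connected_in_def)
  then show ?thesis by induction (use const in auto)
qed

definition monochromatic_edges :: "'a graph \<Rightarrow> ('a \<Rightarrow> nat) \<Rightarrow> 'a set set" where
  "monochromatic_edges G f = {e \<in> snd G. \<forall>u\<in>e. \<forall>v\<in>e. f u = f v}"

lemma monochromatic_edges_iff:
  "{u, v} \<in> monochromatic_edges G f \<longleftrightarrow> {u, v} \<in> snd G \<and> f u = f v"
  by (auto simp: monochromatic_edges_def)

text \<open>Along monochromatic edges the color never changes, so \<open>f\<close> is constant on
  each component, and every edge of \<open>G\<close> inside a component is monochromatic.\<close>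

lemma monochromatic_edges_flat: "monochromatic_edges G f \<in> flats G"
proof -
  let ?F = "monochromatic_edges G f"
  have "e \<in> ?F" if C: "C \<in> graph_components (fst G, ?F)" and e: "e \<in> snd G" "e \<subseteq> C" for C e
  proof -
    obtain w where "C = connected_in (fst G, ?F) `` {w}"
      using C by (auto simp: graph_components_def elim: quotientE)
    then have "f w = f v" if "v \<in> e" for v
      using that e(2) constant_on_connected_in[of "(fst G, ?F)" f w v]
      by (auto simp: monochromatic_edges_iff)
    then have "\<forall>u\<in>e. \<forall>v\<in>e. f u = f v" by metis
    then show ?thesis unfolding monochromatic_edges_def using e(1) by blast
  qed
  moreover have "?F \<subseteq> snd G" by (auto simp: monochromatic_edges_def)
  ultimately show ?thesis unfolding flats_def edges_within_def by auto
qed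

text \<open>The components of a flat are induced subgraphs, so an edge of \<open>G\<close> inside
  one of them belongs to \<open>F\<close>. Consequently contracting a flat creates no loops.\<close>

lemma flat_components_distinct:
  assumes F: "F \<in> flats G" and u: "u \<in> fst G" and v: "v \<in> fst G" and e: "{u, v} \<in> snd G"
  shows "{u, v} \<in> F \<longleftrightarrow> connected_in (fst G, F) `` {u} = connected_in (fst G, F) `` {v}"
proof -
  let ?C = "connected_in (fst G, F) `` {u}"
  have eq: "equiv (fst G) (connected_in (fst G, F))" using equiv_connected_in[of "(fst G, F)"] by simp
  have "{u, v} \<in> F" if uv: "(u, v) \<in> connected_in (fst G, F)"
  proof -
    have "?C \<in> graph_components (fst G, F)"
      unfolding graph_components_def using u by (auto intro: quotientI)
    then have "edges_within (fst G, F) ?C = edges_within G ?C" using F by (simp add: flats_def)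
    moreover have "{u, v} \<subseteq> ?C" using uv equiv_class_self[OF eq u] by simp
    ultimately show ?thesis using e unfolding edges_within_def by auto
  qed
  moreover have "(u, v) \<in> connected_in (fst G, F)" if "{u, v} \<in> F"
    using u v that by (rule connected_in_edge)
  ultimately show ?thesis using eq_equiv_class_iff[OF eq u v] by blast
qed

lemma graph_contraction_edgeE:
  assumes G: "simple_graph G" and F: "F \<in> flats G" and e: "e \<in> snd (graph_contraction G F)"
  obtains u v where "e = {connected_in (fst G, F) `` {u}, connected_in (fst G, F) `` {v}}"
    "connected_in (fst G, F) `` {u} \<noteq> connected_in (fst G, F) `` {v}"
    "{u, v} \<in> snd G" "{u, v} \<notin> F" "u \<in> fst G" "v \<in> fst G"
proof -
  obtain d where d: "d \<in> snd G" "d \<notin> F" "e = (\<lambda>v. connected_in (fst G, F) `` {v}) ` d"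
    using e by (auto simp: graph_contraction_def)
  obtain u v where uv: "d = {u, v}" "u \<in> fst G" "v \<in> fst G" using simple_graph_edgeE[OF G d(1)] .
  show thesis
    by (rule that[of u v]) (use d uv flat_components_distinct[OF F uv(2,3)] in auto)
qed

lemma simple_graph_contraction:
  assumes G: "simple_graph G" and F: "F \<in> flats G"
  shows "simple_graph (graph_contraction G F)"
proof -
  have "finite (graph_components (fst G, F))"
    unfolding graph_components_def
    using simple_graphD(1)[OF G] equiv_connected_in[of "(fst G, F)"]
    by (simp add: finite_quotient equiv_type)
  moreover have "e \<subseteq> graph_components (fst G, F) \<and> card e = 2"
    if e: "e \<in> snd (graph_contraction G F)" for e
    by (rule graph_contraction_edgeE[OF G F e]) (auto simp: graph_components_def intro: quotientI)
  ultimately show ?thesis by (simp add: simple_graph_def graph_contraction_def)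
qed

text \<open>A coloring whose monochromatic edges form \<open>F\<close> is constant on the components
  of \<open>F\<close> and so descends to the contraction; it is proper there because the edges
  outside \<open>F\<close> are not monochromatic. Composition with the quotient map is the
  inverse.\<close>

lemma card_colorings_monochromatic_edges:
  assumes G: "simple_graph G" and F: "F \<in> flats G"
  shows "card {f \<in> fst G \<rightarrow>\<^sub>E {1..t}. monochromatic_edges G f = F}
    = card (proper_colorings (graph_contraction G F) t)"
proof (rule sym, rule bij_betw_same_card)
  let ?H = "graph_contraction G F" and ?K = "connected_in (fst G, F)"
  \<comment> \<open>\<open>?desc\<close> reads off the color of a component at a chosen vertex of
    it.\<close>
  let ?lift = "\<lambda>g. \<lambda>v\<in>fst G. g (?K `` {v})"
    and ?desc = "\<lambda>f. \<lambda>C\<in>fst ?H. f (SOME v. v \<in> C)"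
  have eq: "equiv (fst G) ?K" using equiv_connected_in[of "(fst G, F)"] by simp
  have H: "fst ?H = fst G // ?K" by (simp add: graph_contraction_def graph_components_def)
  have rep: "(SOME v. v \<in> C) \<in> fst G" "?K `` {SOME v. v \<in> C} = C" if C: "C \<in> fst ?H" for C
  proof -
    obtain w where w: "w \<in> fst G" "C = ?K `` {w}" using C unfolding H by (rule quotientE)
    have "w \<in> C" using w equiv_class_self[OF eq] by simp
    then have "(SOME v. v \<in> C) \<in> C" by (rule someI)
    then have "(w, SOME v. v \<in> C) \<in> ?K" using w(2) by simp
    then have "?K `` {w} = ?K `` {SOME v. v \<in> C}" by (rule equiv_class_eq[OF eq])
    then show "?K `` {SOME v. v \<in> C} = C" using w(2) by metis
    show "(SOME v. v \<in> C) \<in> fst G"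
      using \<open>(w, SOME v. v \<in> C) \<in> ?K\<close> by (simp add: connected_in_def)
  qed
  have quot: "?K `` {v} \<in> fst ?H" if "v \<in> fst G" for v unfolding H using that by (rule quotientI)
  have desc: "?desc f (?K `` {v}) = f v" if f: "monochromatic_edges G f = F" and v: "v \<in> fst G" for f v
  proof -
    have "(v, SOME u. u \<in> ?K `` {v}) \<in> ?K"
      using rep[OF quot[OF v]] v eq_equiv_class_iff[OF eq] by metis
    then have "f v = f (SOME u. u \<in> ?K `` {v})"
      by (rule constant_on_connected_in[rotated]) (use f in \<open>auto simp: monochromatic_edges_iff\<close>)
    then show ?thesis using quot[OF v] by simp
  qed
  show "bij_betw ?lift (proper_colorings ?H t) {f \<in> fst G \<rightarrow>\<^sub>E {1..t}. monochromatic_edges G f = F}"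
  proof (rule bij_betw_byWitness[where f' = ?desc]; (intro ballI image_subsetI)?)
    fix g assume g: "g \<in> proper_colorings ?H t"
    then have gE: "g \<in> fst ?H \<rightarrow>\<^sub>E {1..t}" by (simp add: proper_colorings_def)
    show "?desc (?lift g) = g"
    proof (rule extensionalityI[of _ "fst ?H"])
      show "g \<in> extensional (fst ?H)" using gE by (simp add: PiE_def)
    qed (use rep in auto)
    have "?lift g \<in> fst G \<rightarrow>\<^sub>E {1..t}"
      unfolding restrict_PiE_iff using gE quot by blast
    moreover have "monochromatic_edges G (?lift g) = F"
    proof (rule set_eqI)
      fix e
      show "e \<in> monochromatic_edges G (?lift g) \<longleftrightarrow> e \<in> F"
      proof (cases "e \<in> snd G")
        case False
        then show ?thesis using F by (auto simp: flats_def monochromatic_edges_def)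
      next
        case True
        obtain u v where uv: "e = {u, v}" "u \<in> fst G" "v \<in> fst G" using simple_graph_edgeE[OF G True] .
        \<comment> \<open>An edge outside \<open>F\<close> survives as an edge of the contraction,
          where \<open>g\<close> is proper.\<close>
        have "g (?K `` {u}) \<noteq> g (?K `` {v})" if "e \<notin> F"
        proof -
          have "{?K `` {u}, ?K `` {v}} \<in> snd ?H"
            using True that uv(1) by (auto simp: graph_contraction_def image_iff intro!: bexI[of _ e])
          then show ?thesis using g by (simp add: proper_colorings_def)
        qed
        then have "g (?K `` {u}) = g (?K `` {v}) \<longleftrightarrow> e \<in> F"
          using flat_components_distinct[OF F uv(2,3)] True uv(1) by auto
        then show ?thesis using True uv by (simp add: monochromatic_edges_iff)
      qed
    qed
    ultimately show "?lift g \<in> {f \<in> fst G \<rightarrow>\<^sub>E {1..t}. monochromatic_edges G f = F}" by blast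
  next
    fix f assume "f \<in> {f \<in> fst G \<rightarrow>\<^sub>E {1..t}. monochromatic_edges G f = F}"
    then have fE: "f \<in> fst G \<rightarrow>\<^sub>E {1..t}" and f: "monochromatic_edges G f = F" by auto
    show "?lift (?desc f) = f"
    proof (rule extensionalityI[of _ "fst G"])
      show "f \<in> extensional (fst G)" using fE by (simp add: PiE_def)
    next
      fix v assume "v \<in> fst G"
      then show "?lift (?desc f) v = f v" using desc[OF f, of v] by (simp only: restrict_apply' if_True)
    qed (rule restrict_extensional)
    have "?desc f \<in> fst ?H \<rightarrow>\<^sub>E {1..t}"
      unfolding restrict_PiE_iff using fE rep(1) by blast
    moreover have "?desc f B \<noteq> ?desc f C" if e: "{B, C} \<in> snd ?H" for B C
    proof (rule graph_contraction_edgeE[OF G F e])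
      fix u v assume BC: "{B, C} = {?K `` {u}, ?K `` {v}}" and uv: "{u, v} \<in> snd G" "{u, v} \<notin> F"
        "u \<in> fst G" "v \<in> fst G"
      have "f u \<noteq> f v" using uv(1,2) f monochromatic_edges_iff by metis
      then have "?desc f (?K `` {u}) \<noteq> ?desc f (?K `` {v})" using desc[OF f] uv(3,4) by metis
      then show ?thesis using BC unfolding doubleton_eq_iff by metis
    qed
    ultimately show "?desc f \<in> proper_colorings ?H t" unfolding proper_colorings_def by blast
  qed
qed

section \<open>Simplicial colorings in terms of dimension\<close>

text \<open>A face has one vertex more than its dimension, so the strict bound becomes a weak one.
  For the complex without faces both sides hold, its dimension being -1.\<close>

lemma complex_dim_less_iff:
  assumes "finite \<Gamma>" "s > 0"
  shows "complex_dim \<Gamma> < int s \<longleftrightarrow> (\<forall>X\<in>\<Gamma>. card X \<le> s)"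
proof (cases "\<Gamma> = {}")
  case False
  then have "complex_dim \<Gamma> < int s \<longleftrightarrow> (\<forall>X\<in>\<Gamma>. face_dim X < int s)"
    using assms(1) by (simp add: complex_dim_def)
  also have "\<dots> \<longleftrightarrow> (\<forall>X\<in>\<Gamma>. card X \<le> s)" by (auto simp: face_dim_def)
  finally show ?thesis .
qed (use assms in \<open>simp add: complex_dim_def\<close>)

lemma snd_skeleton_graph: "snd (skeleton_graph V \<Gamma>) = {X \<in> \<Gamma>. card X = 2}"
  by (auto simp: skeleton_graph_def skeleton_def face_dim_def)

text \<open>The faces of the subcomplex are the faces of \<Gamma> on which \<open>f\<close> is
  constant. The vertices of one color in a face of \<Gamma> form such a face, and conversely each
  nonempty such face consists of all its vertices of a single color.\<close>

lemma simplicial_coloring_iff: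
  assumes \<Gamma>: "abstract_simplicial_complex V \<Gamma>" and s: "s > 0" and f: "f \<in> V \<rightarrow>\<^sub>E {1..t}"
  shows "f \<in> simplicial_colorings V \<Gamma> s t \<longleftrightarrow>
    complex_dim (flat_subcomplex \<Gamma> (monochromatic_edges (skeleton_graph V \<Gamma>) f)) < int s"
proof -
  let ?F = "monochromatic_edges (skeleton_graph V \<Gamma>) f"
  have fin: "finite \<Gamma>" and down: "\<And>X Y. X \<in> \<Gamma> \<Longrightarrow> Y \<subseteq> X \<Longrightarrow> Y \<in> \<Gamma>" and finX: "\<And>X. X \<in> \<Gamma> \<Longrightarrow> finite X"
    using \<Gamma> unfolding abstract_simplicial_complex_def
    by (auto intro: finite_subset[of \<Gamma> "Pow V"] finite_subset[of _ V])
  have sub: "X \<in> flat_subcomplex \<Gamma> ?F \<longleftrightarrow> X \<in> \<Gamma> \<and> (\<forall>u\<in>X. \<forall>v\<in>X. f u = f v)" for X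
  proof (intro iffI conjI ballI)
    assume X: "X \<in> flat_subcomplex \<Gamma> ?F"
    then show "X \<in> \<Gamma>" by (simp add: flat_subcomplex_def)
    fix u v assume uv: "u \<in> X" "v \<in> X"
    show "f u = f v"
    proof (cases "u = v")
      case False
      then have "{u, v} \<in> ?F" using X uv by (simp add: flat_subcomplex_def)
      then show ?thesis by (simp add: monochromatic_edges_iff)
    qed simp
  next
    assume X: "X \<in> \<Gamma> \<and> (\<forall>u\<in>X. \<forall>v\<in>X. f u = f v)"
    have "Y \<in> ?F" if Y: "Y \<subseteq> X" "card Y = 2" for Y
      unfolding monochromatic_edges_def snd_skeleton_graph using X down Y by blast
    then show "X \<in> flat_subcomplex \<Gamma> ?F" unfolding flat_subcomplex_def using X by blast
  qed
  have "(\<forall>X\<in>\<Gamma>. \<forall>c. card {v \<in> X. f v = c} \<le> s) \<longleftrightarrow> (\<forall>X\<in>flat_subcomplex \<Gamma> ?F. card X \<le> s)"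
  proof (intro iffI ballI allI)
    fix X assume col: "\<forall>X\<in>\<Gamma>. \<forall>c. card {v \<in> X. f v = c} \<le> s" and "X \<in> flat_subcomplex \<Gamma> ?F"
    then have X: "X \<in> \<Gamma>" "\<And>u v. u \<in> X \<Longrightarrow> v \<in> X \<Longrightarrow> f u = f v" using sub by blast+
    show "card X \<le> s"
    proof (cases "X = {}")
      case False
      then obtain u where "u \<in> X" by blast
      then have "{v \<in> X. f v = f u} = X" using X(2) by blast
      then show ?thesis using col X(1) by metis
    qed simp
  next
    fix X c assume "\<forall>X\<in>flat_subcomplex \<Gamma> ?F. card X \<le> s" "X \<in> \<Gamma>"
    moreover have "{v \<in> X. f v = c} \<in> flat_subcomplex \<Gamma> ?F"
      unfolding sub using down[OF \<open>X \<in> \<Gamma>\<close>, of "{v \<in> X. f v = c}"] by simp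
    ultimately show "card {v \<in> X. f v = c} \<le> s" by blast
  qed
  moreover have "finite (flat_subcomplex \<Gamma> ?F)" using fin by (simp add: flat_subcomplex_def)
  ultimately show ?thesis using f s by (simp add: simplicial_colorings_def complex_dim_less_iff)
qed

section \<open>The simplicial chromatic polynomial and its value at -1\<close>

text \<open>Two polynomials that agree at all natural numbers have a difference with infinitely many
  roots, so the definite description is determined.\<close>

lemma simplicial_chromatic_poly_eqI:
  assumes "\<And>t. poly p (real t) = real (card (simplicial_colorings V \<Gamma> s t))"
  shows "simplicial_chromatic_poly V \<Gamma> s = p"
  unfolding simplicial_chromatic_poly_def
proof (rule the_equality)
  fix q assume q: "\<forall>t. poly q (real t) = real (card (simplicial_colorings V \<Gamma> s t))"
  have "range real \<subseteq> {x. poly (q - p) x = 0}" using q assms by auto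
  then have "infinite {x. poly (q - p) x = 0}"
    using range_inj_infinite[OF inj_of_nat] finite_subset by blast
  then have "q - p = 0" using poly_roots_finite by blast
  then show "q = p" by simp
qed (use assms in simp)

theorem theorem4p3:
  fixes V :: "'a set" and \<Gamma> :: "'a set set" and n s :: nat
  assumes "abstract_simplicial_complex V \<Gamma>"
    and "card V = n"
    and "s > 0"
  shows "poly (simplicial_chromatic_poly V \<Gamma> s) (-1) =
    (\<Sum>F \<in> {F \<in> flats (skeleton_graph V \<Gamma>). complex_dim (flat_subcomplex \<Gamma> F) < int s}.
       (-1) ^ card (graph_components (V, F)) *
       real (card (acyclic_orientations (graph_contraction (skeleton_graph V \<Gamma>) F))))"
proof -
  let ?G = "skeleton_graph V \<Gamma>"
  let ?I = "{F \<in> flats ?G. complex_dim (flat_subcomplex \<Gamma> F) < int s}"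
  have V: "fst ?G = V" by (simp add: skeleton_graph_def)
  have G: "simple_graph ?G"
    using assms(1) by (auto simp: simple_graph_def V snd_skeleton_graph abstract_simplicial_complex_def)
  have "?I \<subseteq> Pow (snd ?G)" by (auto simp: flats_def)
  then have finI: "finite ?I" using simple_graphD(2)[OF G] by (meson finite_Pow_iff finite_subset)
  \<comment> \<open>The exponent c(F) in the formula is the number of vertices of the
    contraction.\<close>
  have contraction: "fst (graph_contraction ?G F) = graph_components (V, F)" for F
    by (simp add: graph_contraction_def V)
  have "\<forall>F\<in>?I. \<exists>p. (\<forall>t. poly p (real t) = real (card (proper_colorings (graph_contraction ?G F) t))) \<and>
      poly p (-1) = (-1) ^ card (graph_components (V, F)) *
        real (card (acyclic_orientations (graph_contraction ?G F)))"
    using stanley_reciprocity[OF simple_graph_contraction[OF G]] unfolding contraction by blast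
  from bchoice[OF this] obtain P :: "'a set set \<Rightarrow> real poly" where
    P: "\<And>F t. F \<in> ?I \<Longrightarrow> poly (P F) (real t) = real (card (proper_colorings (graph_contraction ?G F) t))"
    and P': "\<And>F. F \<in> ?I \<Longrightarrow> poly (P F) (-1) = (-1) ^ card (graph_components (V, F)) *
        real (card (acyclic_orientations (graph_contraction ?G F)))" by blast
  have "simplicial_chromatic_poly V \<Gamma> s = (\<Sum>F\<in>?I. P F)"
  proof (rule simplicial_chromatic_poly_eqI)
    fix t
    let ?S = "simplicial_colorings V \<Gamma> s t"
    have SV: "?S \<subseteq> V \<rightarrow>\<^sub>E {1..t}" by (auto simp: simplicial_colorings_def)
    have "finite (V \<rightarrow>\<^sub>E {1..t})"
      using simple_graphD(1)[OF G] by (intro finite_PiE) (auto simp: V)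
    with SV have finS: "finite ?S" by (rule finite_subset)
    have iff: "f \<in> ?S \<longleftrightarrow> monochromatic_edges ?G f \<in> ?I" if "f \<in> V \<rightarrow>\<^sub>E {1..t}" for f
      using simplicial_coloring_iff[OF assms(1,3) that] monochromatic_edges_flat by blast
    have img: "monochromatic_edges ?G ` ?S \<subseteq> ?I"
      using iff SV by blast
    \<comment> \<open>Whether \<open>f\<close> is a simplicial coloring depends only on its flat, so
      for an admissible \<open>F\<close> every coloring with flat \<open>F\<close> is
      simplicial.\<close>
    have "card (proper_colorings (graph_contraction ?G F) t) = card {f \<in> ?S. monochromatic_edges ?G f = F}"
      if F: "F \<in> ?I" for F
    proof -
      have "{f \<in> ?S. monochromatic_edges ?G f = F} = {f \<in> V \<rightarrow>\<^sub>E {1..t}. monochromatic_edges ?G f = F}"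
        using iff SV F by blast
      moreover have "F \<in> flats ?G" using F by blast
      ultimately show ?thesis
        using card_colorings_monochromatic_edges[OF G, of F t] unfolding V by metis
    qed
    then have "poly (\<Sum>F\<in>?I. P F) (real t) = (\<Sum>F\<in>?I. real (card {f \<in> ?S. monochromatic_edges ?G f = F}))"
      unfolding poly_sum using P by (intro sum.cong) simp_all
    also have "\<dots> = real (card ?S)"
      using sum.group[OF finS finI img, of "\<lambda>_. 1::real"] by simp
    finally show "poly (\<Sum>F\<in>?I. P F) (real t) = real (card ?S)" .
  qed
  \<comment> \<open>The equality is one of polynomials, so it may be evaluated at -1 term by
    term.\<close>
  then show ?thesis by (simp only: poly_sum) (intro sum.cong refl P')
qed

end
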